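(* Let $f:\mathbb{R}^n\to\mathbb{R}$ be locally Lipschitz and continuously differentiable on an open set $D$ of full measure in $\mathbb{R}^n$. Let $\mathbf{x}\in\mathbb{R}^n$ be a point at which $f$ is differentiable, $m\in\mathbb{N}$, $\varepsilon>0$, and let $G^m_\varepsilon(\mathbf{x})$ be a gradient bundle of $f$ at $\mathbf{x}$. Suppose that $\mathbf{g}^{I}_\varepsilon\neq\mathbf{0}$ for the set $G^m_\varepsilon(\mathbf{x})$, let $\mathbf{d}^{I}_\varepsilon:=-\lVert\mathbf{g}^{I}_\varepsilon\rVert^{-1}\mathbf{g}^{I}_\varepsilon$, and let $c\in(0,1)$. Then there exists $z_0>0$ such that $$f(\mathbf{x}+t\,\mathbf{d}^{I}_\varepsilon)-f(\mathbf{x})<-t\,c\,\lVert\mathbf{g}^{I}_\varepsilon\rVert\qquad\text{for all } t\in(0,z_0].$$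
   Context: $\lVert\cdot\rVert$ is the Euclidean norm, $B(\mathbf{x},\varepsilon)$ is the closed Euclidean ball centered at $\mathbf{x}$ with radius $\varepsilon$, and $\mathrm{co}$ denotes convex hull. Gradient bundle: given a differentiability point $\mathbf{x}$ of $f$, $\varepsilon>0$ and $m\in\mathbb{N}$, put $\mathbf{s}_0:=\mathbf{x}$ and let $\mathbf{s}_1,\dots,\mathbf{s}_m\in B(\mathbf{x},\varepsilon)$ be sampled points (of the form $\mathbf{x}+\varepsilon\mathbf{u}_j$ with $\mathbf{u}_j$ in the closed unit ball) at which $f$ is differentiable. Then $G^m_\varepsilon(\mathbf{x}):=\mathrm{co}\{\nabla f(\mathbf{s}_0),\dots,\nabla f(\mathbf{s}_m)\}$. For $i=1,\dots,n$ let $G^m_{\varepsilon,i}(\mathbf{x}):=\mathrm{co}\{\frac{\partial f}{\partial x_i}(\mathbf{s}_j): j=0,\dots,m\}\subset\mathbb{R}$. The vector $\mathbf{g}^{I}_\varepsilon=(g^{I}_{\varepsilon,1},\dots,g^{I}_{\varepsilon,n})\in\mathbb{R}^n$ is defined by $g^{I}_{\varepsilon,i}:=\operatorname{argmin}\{|g| : g\in G^m_{\varepsilon,i}(\mathbf{x})\}$. When $\mathbf{g}^{I}_\varepsilon\ne\mathbf{0}$, the direction $\mathbf{d}^{I}_\varepsilon$ is called the (normalized) Ideal direction of $G^m_\varepsilon(\mathbf{x})$. *)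

theory Defs
  imports "HOL-Analysis.Analysis"
begin

definition locally_lipschitz :: "('a::metric_space \<Rightarrow> 'b::metric_space) \<Rightarrow> bool" where
  "locally_lipschitz f \<longleftrightarrow> (\<forall>x. \<exists>r>0. \<exists>L. L-lipschitz_on (cball x r) f)"

text \<open>Unspecified where \<open>f\<close> is not differentiable; likewise the partial derivative below.\<close>

definition grad :: "('a::real_inner \<Rightarrow> real) \<Rightarrow> 'a \<Rightarrow> 'a" where
  "grad f x = (THE g. GDERIV f x :> g)"

definition partial_deriv :: "'n::finite \<Rightarrow> (real^'n \<Rightarrow> real) \<Rightarrow> real^'n \<Rightarrow> real" where
  "partial_deriv i f x = deriv (\<lambda>t. f (x + t *\<^sub>R axis i 1)) 0"

definition cont_differentiable_on :: "('a::real_inner \<Rightarrow> real) \<Rightarrow> 'a set \<Rightarrow> bool" where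
  "cont_differentiable_on f D \<longleftrightarrow>
     (\<forall>x\<in>D. f differentiable (at x)) \<and> continuous_on D (grad f)"

text \<open>\<open>G\<close> is the gradient bundle generated by the points \<open>s 0, \<dots>, s m\<close>; the values of \<open>s\<close>
  beyond \<open>m\<close> are irrelevant.\<close>

definition is_gradient_bundle ::
  "(real^'n \<Rightarrow> real) \<Rightarrow> real^'n \<Rightarrow> real \<Rightarrow> nat \<Rightarrow> (nat \<Rightarrow> real^'n) \<Rightarrow> (real^'n) set \<Rightarrow> bool" where
  "is_gradient_bundle f x \<epsilon> m s G \<longleftrightarrow>
     s 0 = x \<and>
     (\<forall>j\<in>{1..m}. s j \<in> cball x \<epsilon>) \<and>
     (\<forall>j\<in>{0..m}. f differentiable (at (s j))) \<and>
     G = convex hull ((\<lambda>j. grad f (s j)) ` {0..m})"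

definition coord_bundle ::
  "(real^'n \<Rightarrow> real) \<Rightarrow> nat \<Rightarrow> (nat \<Rightarrow> real^'n) \<Rightarrow> 'n \<Rightarrow> real set" where
  "coord_bundle f m s i = convex hull ((\<lambda>j. partial_deriv i f (s j)) ` {0..m})"

text \<open>Each minimizer exists and is unique, since \<open>coord_bundle f m s i\<close> is a nonempty compact
  interval.\<close>

definition ideal_vector :: "(real^'n \<Rightarrow> real) \<Rightarrow> nat \<Rightarrow> (nat \<Rightarrow> real^'n) \<Rightarrow> real^'n" where
  "ideal_vector f m s = (\<chi> i. ARG_MIN abs g. g \<in> coord_bundle f m s i)"

definition ideal_direction :: "(real^'n \<Rightarrow> real) \<Rightarrow> nat \<Rightarrow> (nat \<Rightarrow> real^'n) \<Rightarrow> real^'n" where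
  "ideal_direction f m s = - (inverse (norm (ideal_vector f m s)) *\<^sub>R ideal_vector f m s)"

end

theory Submission imports Defs begin

text \<open>The minimal-modulus element \<open>g\<^sub>i\<close> of the interval spanned by the \<open>i\<close>-th partial derivatives is
  the projection of \<open>0\<close> onto it, so \<open>g\<^sub>i * p \<ge> g\<^sub>i\<^sup>2\<close> for every \<open>p\<close> in that interval, in particular
  for the partial derivative at \<open>x\<close> itself, because \<open>s 0 = x\<close>. Summing over \<open>i\<close>, the derivative of
  \<open>f\<close> at \<open>x\<close> in direction \<open>g\<close> is at least the squared norm of \<open>g\<close>; hence the slope along the ideal
  direction is at most \<open>- norm g\<close>, which is strictly below \<open>- c * norm g\<close>.\<close>

lemma has_derivative_imp_directional_derivative:
  fixes f :: "'a::real_normed_vector \<Rightarrow> real"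
  assumes "(f has_derivative f') (at x)"
  shows "((\<lambda>t. f (x + t *\<^sub>R d)) has_real_derivative f' d) (at 0)"
proof -
  interpret bounded_linear f'
    using assms by (rule has_derivative_bounded_linear)
  have "((\<lambda>t. f (x + t *\<^sub>R d)) has_derivative (\<lambda>t. f' (t *\<^sub>R d))) (at 0)"
    by (rule has_derivative_compose[where g = f])
       (auto intro!: derivative_eq_intros assms)
  moreover have "(\<lambda>t. f' (t *\<^sub>R d)) = (*) (f' d)"
    by (simp add: fun_eq_iff scaleR mult.commute)
  ultimately show ?thesis
    by (simp add: has_field_derivative_def)
qed

text \<open>Tilting by the line of slope \<open>b\<close> gives a function of \<open>t\<close> with
  negative derivative \<open>f' d - b\<close> at 0, so it drops strictly below its value
  \<open>f x\<close> just to the right of 0.\<close>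

lemma has_derivative_imp_directional_less:
  fixes f :: "'a::real_normed_vector \<Rightarrow> real"
  assumes "(f has_derivative f') (at x)" and "f' d < b"
  shows "\<exists>z>0. \<forall>t\<in>{0<..z}. f (x + t *\<^sub>R d) - f x < t * b"
proof -
  have "((\<lambda>t. f (x + t *\<^sub>R d) - t * b) has_real_derivative f' d - b) (at 0)"
    by (auto intro!: derivative_eq_intros has_derivative_imp_directional_derivative assms)
  then obtain e where "e > 0"
    and e: "\<And>h. 0 < h \<Longrightarrow> h < e \<Longrightarrow> f (x + h *\<^sub>R d) - h * b < f x"
    using has_real_derivative_neg_dec_right[of _ "f' d - b" 0 UNIV] assms(2) by force
  \<comment> \<open>The bound holds on the open interval up to \<open>e\<close>; halving
    \<open>e\<close> makes room for the closed right endpoint.\<close>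
  have "f (x + t *\<^sub>R d) - f x < t * b" if "t \<in> {0<..e/2}" for t
    using e[of t] that \<open>e > 0\<close> by auto
  then show ?thesis
    using \<open>e > 0\<close> by (intro exI[of _ "e/2"]) auto
qed

lemma partial_deriv_eq:
  assumes "(f has_derivative f') (at x)"
  shows "partial_deriv i f x = f' (axis i 1)"
  unfolding partial_deriv_def
  by (intro DERIV_imp_deriv has_derivative_imp_directional_derivative assms)

lemma arg_min_abs_mult_ge:
  fixes S :: "real set"
  assumes "convex S" "compact S" "p \<in> S"
  shows "(ARG_MIN abs g. g \<in> S)\<^sup>2 \<le> (ARG_MIN abs g. g \<in> S) * p"
proof -
  define g where "g = (ARG_MIN abs g. g \<in> S)"
  \<comment> \<open>\<open>ARG_MIN\<close> is a choice, so it is a minimizer only once one is known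
    to exist; compactness supplies it, with \<open>p\<close> as witness of nonemptiness.\<close>
  obtain y where "y \<in> S" "\<And>z. z \<in> S \<Longrightarrow> \<bar>y\<bar> \<le> \<bar>z\<bar>"
    using continuous_attains_inf[of S abs] assms(2,3) continuous_on_rabs[OF continuous_on_id] by auto
  then have "is_arg_min abs (\<lambda>g. g \<in> S) y"
    by (auto simp: is_arg_min_linorder)
  then have "is_arg_min abs (\<lambda>g. g \<in> S) g"
    unfolding g_def arg_min_def by (rule someI)
  then have "g \<in> S" "\<forall>z\<in>S. dist 0 g \<le> dist 0 z"
    by (auto simp: is_arg_min_linorder)
  \<comment> \<open>Obtuse-angle criterion for the closest point to 0 in a closed convex set; on the
    real line it reads \<open>- g * (p - g) \<le> 0\<close>.\<close>
  then have "inner (0 - g) (p - g) \<le> 0"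
    using any_closest_point_dot[of S g p 0] assms by (simp add: compact_imp_closed)
  then show ?thesis
    by (simp add: g_def[symmetric] power2_eq_square algebra_simps)
qed

lemma ideal_vector_norm_le:
  assumes f': "(f has_derivative f') (at (s 0))"
  shows "(norm (ideal_vector f m s))\<^sup>2 \<le> f' (ideal_vector f m s)"
proof -
  interpret bounded_linear f'
    using f' by (rule has_derivative_bounded_linear)
  define g where "g = ideal_vector f m s"
  have le: "(g $ i)\<^sup>2 \<le> g $ i * f' (axis i 1)" for i
  proof -
    \<comment> \<open>Index 0 lies in \<open>{0..m}\<close>, so the partial derivative at
      \<open>s 0\<close> is a generator of the hull.\<close>
    have "f' (axis i 1) \<in> coord_bundle f m s i"
      unfolding coord_bundle_def partial_deriv_eq[OF f', symmetric]
      by (intro hull_inc imageI) simp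
    moreover have "convex (coord_bundle f m s i)" "compact (coord_bundle f m s i)"
      unfolding coord_bundle_def by (auto intro: finite_imp_compact_convex_hull)
    ultimately show ?thesis
      unfolding g_def ideal_vector_def by (simp add: arg_min_abs_mult_ge)
  qed
  have "(norm g)\<^sup>2 = (\<Sum>i\<in>UNIV. (g $ i)\<^sup>2)"
    unfolding power2_norm_eq_inner inner_vec_def by (simp add: power2_eq_square)
  also have "\<dots> \<le> (\<Sum>i\<in>UNIV. g $ i * f' (axis i 1))"
    by (intro sum_mono le)
  also have "\<dots> = f' (\<Sum>i\<in>UNIV. g $ i *\<^sub>R axis i 1)"
    by (simp add: sum scaleR)
  also have "(\<Sum>i\<in>UNIV. g $ i *\<^sub>R axis i 1) = g"
    by (simp add: basis_expansion flip: scalar_mult_eq_scaleR)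
  finally show ?thesis
    by (simp add: g_def)
qed

theorem lemma4p2:
  fixes f :: "real^'n \<Rightarrow> real" and D G :: "(real^'n) set" and x :: "real^'n"
    and m :: nat and \<epsilon> c :: real and s :: "nat \<Rightarrow> real^'n"
  assumes "locally_lipschitz f"
    and "open D" and "- D \<in> null_sets lebesgue"
    and "cont_differentiable_on f D"
    and "f differentiable (at x)"
    and "\<epsilon> > 0"
    and "is_gradient_bundle f x \<epsilon> m s G"
    and "ideal_vector f m s \<noteq> 0"
    and "0 < c" and "c < 1"
  shows "\<exists>z0>0. \<forall>t\<in>{0<..z0}.
    f (x + t *\<^sub>R ideal_direction f m s) - f x < - (t * c * norm (ideal_vector f m s))"
proof -
  define g where "g = ideal_vector f m s"
  have s0: "s 0 = x"
    using assms(7) by (simp add: is_gradient_bundle_def)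
  obtain f' where f': "(f has_derivative f') (at x)"
    using assms(5) by (auto simp: differentiable_def)
  interpret bounded_linear f'
    using f' by (rule has_derivative_bounded_linear)
  have pos: "norm g > 0"
    using assms(8) by (simp add: g_def)
  have "(norm g)\<^sup>2 \<le> f' g"
    unfolding g_def using f' s0 by (intro ideal_vector_norm_le) simp
  then have "norm g \<le> inverse (norm g) * f' g"
    using pos by (simp add: power2_eq_square field_simps)
  then have "f' (ideal_direction f m s) \<le> - norm g"
    by (simp add: ideal_direction_def g_def[symmetric] neg scaleR)
  also have "\<dots> < - (c * norm g)"
    using pos \<open>c < 1\<close> by simp
  \<comment> \<open>The directional bound is applied with slope
    \<open>b = - (c * norm g)\<close>.\<close>
  finally show ?thesis
    using has_derivative_imp_directional_less[OF f'] by (fastforce simp: g_def mult.assoc)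
qed

end
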